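(* The terminal positions satisfy $*L \in \mathcal{L}$ and $*R \in \mathcal{R}$. Moreover, for any non-terminal position $G = \{G_1, \ldots, G_n\}$: (i) there exist $i,j$ with $G_i \in \mathcal{L} \cup \mathcal{P}$ and $G_j \in \mathcal{R} \cup \mathcal{P}$ if and only if $G \in \mathcal{N}$; (ii) there exists $i$ with $G_i \in \mathcal{L}$ and every $G_j \in \mathcal{L} \cup \mathcal{N}$ if and only if $G \in \mathcal{L}$; (iii) there exists $i$ with $G_i \in \mathcal{R}$ and every $G_j \in \mathcal{R} \cup \mathcal{N}$ if and only if $G \in \mathcal{R}$; (iv) every $G_i \in \mathcal{N}$ if and only if $G \in \mathcal{P}$.
   Context: Positions are defined recursively: $*L$ and $*R$ are terminal positions; if $G_1,\dots,G_n$ ($n\ge 1$) are positions, then $G=\{G_1,\dots,G_n\}$ is a position with options $G_1,\dots,G_n$. All positions have finite game trees. Play: two players, Left and Right, move alternately; from a non-terminal position the player to move chooses any option (both players have the same options). When a terminal position is reached the game ends: Left wins if it is $*L$, Right wins if it is $*R$. The outcome class of $G$ is $\mathcal{L}$ if Left has a winning strategy from $G$ whether she moves first or second, $\mathcal{R}$ if Right has a winning strategy whether he moves first or second, $\mathcal{N}$ if the player who moves first has a winning strategy (whoever that is), and $\mathcal{P}$ if the player who moves second has a winning strategy; every position is in exactly one of these classes. *)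

theory Defs
  imports Main "HOL-Library.FSet"
begin

datatype player = Left | Right

fun opponent :: "player \<Rightarrow> player" where
  "opponent Left = Right"
| "opponent Right = Left"

text \<open>The raw type still admits the empty set of options (at any depth); the predicate
  \<open>position\<close> below excludes it. Finiteness of game trees is built into the datatype.\<close>

datatype game = StarL | StarR | Node "game fset"

inductive position :: "game \<Rightarrow> bool" where
  "position StarL"
| "position StarR"
| "Gs \<noteq> {||} \<Longrightarrow> (\<And>H. H |\<in>| Gs \<Longrightarrow> position H) \<Longrightarrow> position (Node Gs)"

fun moves :: "game \<Rightarrow> game fset" where
  "moves StarL = {||}"
| "moves StarR = {||}"
| "moves (Node Gs) = Gs"

fun won_by :: "player \<Rightarrow> game \<Rightarrow> bool" where
  "won_by Left T \<longleftrightarrow> T = StarL"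
| "won_by Right T \<longleftrightarrow> T = StarR"

text \<open>A complete play from \<open>G\<close> is recorded as the list of the successive positions.\<close>

definition complete_play :: "game \<Rightarrow> game list \<Rightarrow> bool" where
  "complete_play G ps \<longleftrightarrow>
     ps \<noteq> [] \<and> hd ps = G \<and> last ps \<in> {StarL, StarR} \<and>
     (\<forall>i. Suc i < length ps \<longrightarrow> ps ! Suc i |\<in>| moves (ps ! i))"

text \<open>The player who makes the move number \<open>i\<close> (counted from 0) when \<open>F\<close> moves first.\<close>

definition mover :: "player \<Rightarrow> nat \<Rightarrow> player" where
  "mover F i = (if even i then F else opponent F)"

text \<open>A strategy of a player prescribes an option at each position in which that player may
  have to move; its values at positions without options are irrelevant.\<close>

type_synonym strategy = "game \<Rightarrow> game"

definition legal_strategy :: "strategy \<Rightarrow> bool" where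
  "legal_strategy \<sigma> \<longleftrightarrow> (\<forall>H. moves H \<noteq> {||} \<longrightarrow> \<sigma> H |\<in>| moves H)"

definition follows :: "player \<Rightarrow> player \<Rightarrow> strategy \<Rightarrow> game list \<Rightarrow> bool" where
  "follows A F \<sigma> ps \<longleftrightarrow>
     (\<forall>i. Suc i < length ps \<and> mover F i = A \<longrightarrow> ps ! Suc i = \<sigma> (ps ! i))"

text \<open>Player \<open>A\<close> has a winning strategy from \<open>G\<close> when player \<open>F\<close> moves first.\<close>

definition has_winning_strategy :: "player \<Rightarrow> player \<Rightarrow> game \<Rightarrow> bool" where
  "has_winning_strategy A F G \<longleftrightarrow>
     (\<exists>\<sigma>. legal_strategy \<sigma> \<and>
        (\<forall>ps. complete_play G ps \<and> follows A F \<sigma> ps \<longrightarrow> won_by A (last ps)))"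

definition outcome_L :: "game set" where
  "outcome_L = {G. position G \<and> (\<forall>F. has_winning_strategy Left F G)}"

definition outcome_R :: "game set" where
  "outcome_R = {G. position G \<and> (\<forall>F. has_winning_strategy Right F G)}"

definition outcome_N :: "game set" where
  "outcome_N = {G. position G \<and> (\<forall>F. has_winning_strategy F F G)}"

definition outcome_P :: "game set" where
  "outcome_P = {G. position G \<and> (\<forall>F. has_winning_strategy (opponent F) F G)}"

end

theory Submission imports Defs begin

text \<open>Winning strategies are characterised by backward induction: a single positional strategy,
  "move to an option that is won as second player whenever there is one", realises every
  win predicted by the recursion, and conversely two opposing strategies always produce a
  common complete play, so both players cannot have winning strategies at once. Hence a position
  is described by two bits (does Left win moving first, does Left win moving second), the four
  outcome classes are the four values of this pair, and the recursion for the bits gives the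
  four equivalences.\<close>

text \<open>Backward induction, with the second argument naming the player to move. The premise
  \<open>Gs \<noteq> {||}\<close> stops \<open>Node {||}\<close> from being a vacuous win for
  \<open>A\<close>.\<close>

inductive wins :: "player \<Rightarrow> player \<Rightarrow> game \<Rightarrow> bool" for A where
  terminal: "won_by A T \<Longrightarrow> wins A F T"
| own_move: "H |\<in>| Gs \<Longrightarrow> wins A (opponent A) H \<Longrightarrow> wins A A (Node Gs)"
| opponent_move: "Gs \<noteq> {||} \<Longrightarrow> (\<And>H. H |\<in>| Gs \<Longrightarrow> wins A A H) \<Longrightarrow> wins A (opponent A) (Node Gs)"

lemma opponent_neq [simp]: "opponent A \<noteq> A" "A \<noteq> opponent A"
  by (cases A; simp)+

lemma opponent_opponent [simp]: "opponent (opponent A) = A"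
  by (cases A) simp_all

lemma eq_opponent_iff: "F = opponent A \<longleftrightarrow> F \<noteq> A"
  by (cases A; cases F) simp_all

lemma won_by_Node [simp]: "\<not> won_by A (Node Gs)"
  by (cases A) simp_all

lemma wins_StarL [simp]: "wins A F StarL \<longleftrightarrow> A = Left"
  by (cases A) (auto elim: wins.cases intro: wins.terminal)

lemma wins_StarR [simp]: "wins A F StarR \<longleftrightarrow> A = Right"
  by (cases A) (auto elim: wins.cases intro: wins.terminal)

lemma wins_Node_first: "wins A A (Node Gs) \<longleftrightarrow> (\<exists>H. H |\<in>| Gs \<and> wins A (opponent A) H)"
  by (auto elim: wins.cases intro: wins.own_move)

lemma wins_Node_second:
  "wins A (opponent A) (Node Gs) \<longleftrightarrow> Gs \<noteq> {||} \<and> (\<forall>H. H |\<in>| Gs \<longrightarrow> wins A A H)"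
  by (auto elim: wins.cases intro: wins.opponent_move)

text \<open>Negation exchanges the existential clause of the player to move with the universal
  clause of the other player; at the leaves exactly one player wins.\<close>

lemma wins_determined:
  assumes "position G"
  shows "wins (opponent A) F G \<longleftrightarrow> \<not> wins A F G"
  using assms
proof (induction arbitrary: F rule: position.induct)
  case (3 Gs)
  show ?case
  proof (cases "F = A")
    case True
    with 3 wins_Node_second[of "opponent A" Gs] show ?thesis
      by (auto simp: wins_Node_first)
  next
    case False
    then have F: "F = opponent A" by (simp add: eq_opponent_iff)
    show ?thesis
      unfolding F wins_Node_first[of "opponent A"] wins_Node_second[of A] using 3 by auto
  qed
qed (cases A; simp)+

lemma complete_play_singleton [simp]: "complete_play G [H] \<longleftrightarrow> H = G \<and> G \<in> {StarL, StarR}"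
  by (auto simp: complete_play_def)

lemma complete_play_Cons_Cons:
  "complete_play G (G' # H # ps) \<longleftrightarrow>
     G' = G \<and> H |\<in>| moves G \<and> complete_play H (H # ps)"
  unfolding complete_play_def by (auto simp: nth_Cons split: nat.split)

lemma follows_singleton [simp]: "follows A F \<sigma> [H]"
  by (simp add: follows_def)

lemma mover_0 [simp]: "mover F 0 = F"
  by (simp add: mover_def)

lemma mover_Suc [simp]: "mover F (Suc i) = mover (opponent F) i"
  by (simp add: mover_def)

lemma follows_Cons_Cons:
  "follows A F \<sigma> (G # H # ps) \<longleftrightarrow>
     (F = A \<longrightarrow> H = \<sigma> G) \<and> follows A (opponent F) \<sigma> (H # ps)"
  unfolding follows_def by (auto simp: nth_Cons split: nat.split)

text \<open>The two strategies together choose every move, so they trace out one path down the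
  finite game tree. The induction leaves \<open>F\<close> arbitrary because the mover changes at
  each step.\<close>

lemma common_play:
  assumes "position G" "legal_strategy \<sigma>" "legal_strategy \<tau>"
  shows "\<exists>ps. complete_play G ps \<and> follows A F \<sigma> ps \<and> follows (opponent A) F \<tau> ps"
  using assms(1)
proof (induction arbitrary: F rule: position.induct)
  case 1
  show ?case by (rule exI[of _ "[StarL]"]) simp
next
  case 2
  show ?case by (rule exI[of _ "[StarR]"]) simp
next
  case (3 Gs)
  define H where "H = (if F = A then \<sigma> (Node Gs) else \<tau> (Node Gs))"
  have H: "H |\<in>| Gs"
    using assms(2,3) 3(1) by (auto simp: H_def legal_strategy_def dest: spec[of _ "Node Gs"])
  obtain ps where ps: "complete_play H ps" "follows A (opponent F) \<sigma> ps"
      "follows (opponent A) (opponent F) \<tau> ps"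
    using 3(3)[OF H] by blast
  then obtain qs where "ps = H # qs"
    by (cases ps) (auto simp: complete_play_def)
  with ps H have "complete_play (Node Gs) (Node Gs # ps)"
      "follows A F \<sigma> (Node Gs # ps)" "follows (opponent A) F \<tau> (Node Gs # ps)"
    by (auto simp: complete_play_Cons_Cons follows_Cons_Cons H_def)
  then show ?case by blast
qed

text \<open>The fallback branch keeps the strategy legal where no option is winning.\<close>

definition good_move :: "player \<Rightarrow> strategy" where
  "good_move A G =
     (if \<exists>H. H |\<in>| moves G \<and> wins A (opponent A) H
      then SOME H. H |\<in>| moves G \<and> wins A (opponent A) H
      else SOME H. H |\<in>| moves G)"

lemma good_move_wins:
  assumes "H |\<in>| moves G" "wins A (opponent A) H"
  shows "good_move A G |\<in>| moves G \<and> wins A (opponent A) (good_move A G)"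
  using assms someI[of "\<lambda>H. H |\<in>| moves G \<and> wins A (opponent A) H" H]
  by (auto simp: good_move_def)

lemma legal_good_move: "legal_strategy (good_move A)"
  unfolding legal_strategy_def
proof (intro allI impI)
  fix G assume "moves G \<noteq> {||}"
  then have "(SOME H. H |\<in>| moves G) |\<in>| moves G"
    by (auto intro: someI_ex)
  then show "good_move A G |\<in>| moves G"
    using good_move_wins[of _ G A] by (cases "\<exists>H. H |\<in>| moves G \<and> wins A (opponent A) H")
      (auto simp: good_move_def)
qed

text \<open>\<open>wins A F G\<close>, with \<open>F\<close> the player to move, is invariant along
  the play: \<open>good_move\<close> preserves it when \<open>A\<close> moves, the universal clause
  when the opponent does. At the leaf it says that \<open>A\<close> has won.\<close>

lemma good_move_play_won:
  assumes "complete_play G ps" "follows A F (good_move A) ps" "wins A F G"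
  shows "won_by A (last ps)"
  using assms
proof (induction ps arbitrary: G F rule: induct_list012)
  case 1
  then show ?case by (simp add: complete_play_def)
next
  case (2 G')
  then show ?case by auto
next
  case (3 G' H ps)
  from 3(3) have play: "G' = G" "H |\<in>| moves G" "complete_play H (H # ps)"
    by (auto simp: complete_play_Cons_Cons)
  from 3(4) have fol: "F = A \<longrightarrow> H = good_move A G" "follows A (opponent F) (good_move A) (H # ps)"
    by (auto simp: follows_Cons_Cons play)
  \<comment> \<open>Having the option \<open>H\<close>, \<open>G\<close> is not terminal.\<close>
  obtain Gs where G: "G = Node Gs" using play(2) by (cases G) auto
  have "wins A (opponent F) H"
  proof (cases "F = A")
    case True
    with 3(5) G obtain K where "K |\<in>| moves G" "wins A (opponent A) K"
      by (auto simp: wins_Node_first)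
    with good_move_wins fol True show ?thesis by auto
  next
    case False
    then have "F = opponent A" by (simp add: eq_opponent_iff)
    with 3(5) G play(2) show ?thesis by (auto simp: wins_Node_second)
  qed
  from 3(2)[OF play(3) fol(2) this] show ?case by simp
qed

lemma has_winning_strategy_if_wins: "wins A F G \<Longrightarrow> has_winning_strategy A F G"
  unfolding has_winning_strategy_def using legal_good_move good_move_play_won by blast

text \<open>The common play of the two strategies would be won by both players.\<close>

lemma not_has_winning_strategy_both:
  assumes "position G" "has_winning_strategy A F G"
  shows "\<not> has_winning_strategy (opponent A) F G"
proof
  assume "has_winning_strategy (opponent A) F G"
  with assms obtain ps where "won_by A (last ps)" "won_by (opponent A) (last ps)"
    unfolding has_winning_strategy_def using common_play by meson
  then show False by (cases A) auto
qed

text \<open>If \<open>wins A F G\<close> fails, determinacy makes the opponent win by recursion and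
  hence by strategy, which excludes a winning strategy for \<open>A\<close>.\<close>

lemma has_winning_strategy_iff_wins:
  "position G \<Longrightarrow> has_winning_strategy A F G \<longleftrightarrow> wins A F G"
  using has_winning_strategy_if_wins not_has_winning_strategy_both wins_determined by blast

lemma all_player: "(\<forall>F. P F) \<longleftrightarrow> P Left \<and> P Right"
  by (metis player.exhaust)

lemma wins_Right_iff: "position G \<Longrightarrow> wins Right F G \<longleftrightarrow> \<not> wins Left F G"
  using wins_determined[of G Left] by simp

lemma outcome_iff_wins:
  assumes "position G"
  shows "G \<in> outcome_L \<longleftrightarrow> wins Left Left G \<and> wins Left Right G"
    and "G \<in> outcome_R \<longleftrightarrow> \<not> wins Left Left G \<and> \<not> wins Left Right G"
    and "G \<in> outcome_N \<longleftrightarrow> wins Left Left G \<and> \<not> wins Left Right G"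
    and "G \<in> outcome_P \<longleftrightarrow> \<not> wins Left Left G \<and> wins Left Right G"
  using assms
  by (auto simp: outcome_L_def outcome_R_def outcome_N_def outcome_P_def all_player
      has_winning_strategy_iff_wins wins_Right_iff)

theorem theorem2p8:
  shows "StarL \<in> outcome_L \<and> StarR \<in> outcome_R \<and>
    (\<forall>Gs. position (Node Gs) \<longrightarrow>
      (((\<exists>H. H |\<in>| Gs \<and> H \<in> outcome_L \<union> outcome_P) \<and>
        (\<exists>K. K |\<in>| Gs \<and> K \<in> outcome_R \<union> outcome_P)) \<longleftrightarrow> Node Gs \<in> outcome_N) \<and>
      (((\<exists>H. H |\<in>| Gs \<and> H \<in> outcome_L) \<and>
        (\<forall>K. K |\<in>| Gs \<longrightarrow> K \<in> outcome_L \<union> outcome_N)) \<longleftrightarrow> Node Gs \<in> outcome_L) \<and>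
      (((\<exists>H. H |\<in>| Gs \<and> H \<in> outcome_R) \<and>
        (\<forall>K. K |\<in>| Gs \<longrightarrow> K \<in> outcome_R \<union> outcome_N)) \<longleftrightarrow> Node Gs \<in> outcome_R) \<and>
      ((\<forall>H. H |\<in>| Gs \<longrightarrow> H \<in> outcome_N) \<longleftrightarrow> Node Gs \<in> outcome_P))"
proof (intro conjI allI impI)
  show "StarL \<in> outcome_L" "StarR \<in> outcome_R"
    by (simp_all add: outcome_iff_wins position.intros)
next
  fix Gs
  assume G: "position (Node Gs)"
  then have ne: "Gs \<noteq> {||}" and opt: "\<And>H. H |\<in>| Gs \<Longrightarrow> position H"
    by (auto elim: position.cases)
  have first: "wins Left Left (Node Gs) \<longleftrightarrow> (\<exists>H. H |\<in>| Gs \<and> wins Left Right H)"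
    using wins_Node_first[of Left Gs] by simp
  have second: "wins Left Right (Node Gs) \<longleftrightarrow> (\<forall>H. H |\<in>| Gs \<longrightarrow> wins Left Left H)"
    using wins_Node_second[of Left Gs] ne by simp
  \<comment> \<open>The equivalences for an option \<open>H\<close> are conditional on
    \<open>H |\<in>| Gs\<close>; under an existential quantifier, \<open>conj_cong\<close> supplies
    that membership.\<close>
  note outcome = outcome_iff_wins[OF G] outcome_iff_wins[OF opt] first second
  show "((\<exists>H. H |\<in>| Gs \<and> H \<in> outcome_L \<union> outcome_P) \<and>
      (\<exists>K. K |\<in>| Gs \<and> K \<in> outcome_R \<union> outcome_P)) \<longleftrightarrow> Node Gs \<in> outcome_N"
    \<comment> \<open>The first union collects the options that Left wins moving second, the other
      those that Left loses moving first.\<close>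
    by (auto simp: outcome cong: conj_cong)
  show "((\<exists>H. H |\<in>| Gs \<and> H \<in> outcome_L) \<and>
      (\<forall>K. K |\<in>| Gs \<longrightarrow> K \<in> outcome_L \<union> outcome_N)) \<longleftrightarrow> Node Gs \<in> outcome_L"
    \<comment> \<open>Left wins every option moving first, so one that she also wins moving second
      lies in \<open>outcome_L\<close>.\<close>
    by (auto simp: outcome cong: conj_cong)
  show "((\<exists>H. H |\<in>| Gs \<and> H \<in> outcome_R) \<and>
      (\<forall>K. K |\<in>| Gs \<longrightarrow> K \<in> outcome_R \<union> outcome_N)) \<longleftrightarrow> Node Gs \<in> outcome_R"
    by (auto simp: outcome cong: conj_cong)
  show "(\<forall>H. H |\<in>| Gs \<longrightarrow> H \<in> outcome_N) \<longleftrightarrow> Node Gs \<in> outcome_P"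
    by (auto simp: outcome cong: conj_cong)
qed

end
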